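(* Let $p$ and $r$ be distinct prime numbers. Then: (i) $\Phi_p^{-1}\bmod \Phi_1 = 1/p$, and $\Phi_1^{-1}\bmod\Phi_p = -\frac{1}{p}\left(X^{p-2}+2X^{p-3}+\cdots+(p-2)X+(p-1)\right)$, i.e. $-\frac1p\sum_{k=0}^{p-2}(p-1-k)X^k$. (ii) $\Phi_{pr}^{-1}\bmod\Phi_1 = 1$, and $\Phi_1^{-1}\bmod\Phi_{pr}=\sum_{i=0}^{\varphi(pr)-1}v_iX^i$ with all $v_i\in\{-1,0,1\}$. (iii) For every nonnegative integer $d$ with $d\equiv r-1 \pmod p$, one has $\Phi_{pr}\cdot\frac{1}{r}\sum_{i=0}^{d}X^i\equiv 1 \pmod{\Phi_p}$ in $\mathbb{Q}[X]$ (i.e. $\Phi_{pr}^{-1}\bmod\Phi_p=\frac1r\sum_{i=0}^dX^i$); and $\Phi_p^{-1}\bmod\Phi_{pr}=\frac{1}{r}\sum_{i=0}^{\varphi(pr)-1}v_iX^i$ where the $v_i$ are integers with $v_i<r$ for all $i$. (iv) $\Phi_p^{-1}\bmod\Phi_r=\sum_{i=0}^{\varphi(r)-1}v_iX^i$ with all $v_i\in\{-1,0,1\}$.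
   Context: For a positive integer $k$, $\Phi_k\in\mathbb{Z}[X]$ denotes the $k$-th cyclotomic polynomial (monic, of degree $\varphi(k)$, whose roots are the primitive $k$-th roots of unity); $\varphi$ is Euler's totient function. When $\Phi_m$ and $\Phi_n$ are coprime in $\mathbb{Q}[X]$, $\Phi_m^{-1}\bmod\Phi_n$ denotes the unique polynomial $U\in\mathbb{Q}[X]$ with $\deg U<\varphi(n)$ such that $\Phi_m U\equiv 1\pmod{\Phi_n}$ (equivalently, $\Phi_mU+\Phi_nV=1$ for some $V\in\mathbb{Q}[X]$); in particular for $n=1$ it is a constant. *)

theory Defs
  imports Complex_Main
    "HOL-Computational_Algebra.Computational_Algebra"
    "HOL-Computational_Algebra.Field_as_Ring"
    "HOL-Number_Theory.Totient"
begin

definition primitive_roots_unity :: "nat \<Rightarrow> complex set" where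
  "primitive_roots_unity k = {z. z ^ k = 1 \<and> (\<forall>j. 0 < j \<and> j < k \<longrightarrow> z ^ j \<noteq> 1)}"

text \<open>For \<open>k > 0\<close> the product has integer coefficients: see \<open>ex1_cyclotomic\<close> and
  \<open>map_poly_cyclotomic\<close>.\<close>

definition cyclotomic :: "nat \<Rightarrow> int poly" where
  "cyclotomic k =
     (THE P. map_poly of_int P = (\<Prod>z\<in>primitive_roots_unity k. [:-z, 1:]))"

abbreviation cyclotomic_rat :: "nat \<Rightarrow> rat poly" where
  "cyclotomic_rat k \<equiv> map_poly of_int (cyclotomic k)"

text \<open>The inverse of the \<open>m\<close>-th modulo the \<open>n\<close>-th cyclotomic polynomial, unspecified if there
  is none. It exists uniquely for distinct positive \<open>m\<close> and \<open>n\<close>: see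
  \<open>ex1_cyclotomic_inv_mod\<close>.\<close>

definition cyclotomic_inv_mod :: "nat \<Rightarrow> nat \<Rightarrow> rat poly" where
  "cyclotomic_inv_mod m n =
     (THE U. degree U < totient n \<and> [cyclotomic_rat m * U = 1] (mod cyclotomic_rat n))"

lemma primitive_root_power_eq_1_iff:
  assumes "k > 0" "z \<in> primitive_roots_unity k"
  shows "z ^ j = 1 \<longleftrightarrow> k dvd j"
proof
  assume "z ^ j = 1"
  have "z ^ j = (z ^ k) ^ (j div k) * z ^ (j mod k)"
    by (metis mult_div_mod_eq power_add power_mult)
  with \<open>z ^ j = 1\<close> assms(2) have "z ^ (j mod k) = 1"
    by (simp add: primitive_roots_unity_def)
  moreover have "j mod k < k"
    using assms(1) by simp
  ultimately have "j mod k = 0"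
    using assms(2) by (auto simp: primitive_roots_unity_def)
  thus "k dvd j" by auto
next
  assume "k dvd j"
  thus "z ^ j = 1"
    using assms(2) by (auto simp: primitive_roots_unity_def power_mult)
qed

lemma disjoint_primitive_roots_unity:
  assumes "m > 0" "n > 0" "m \<noteq> n"
  shows "primitive_roots_unity m \<inter> primitive_roots_unity n = {}"
proof (rule ccontr)
  assume "primitive_roots_unity m \<inter> primitive_roots_unity n \<noteq> {}"
  then obtain z where z: "z \<in> primitive_roots_unity m" "z \<in> primitive_roots_unity n"
    by blast
  have "m dvd j \<longleftrightarrow> n dvd j" for j
    using primitive_root_power_eq_1_iff[OF assms(1) z(1)]
      primitive_root_power_eq_1_iff[OF assms(2) z(2)] by blast
  hence "m = n"
    by (meson dvd_antisym dvd_refl)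
  with assms(3) show False by contradiction
qed

lemma roots_unity_eq_Union:
  assumes "n > 0"
  shows "{z::complex. z ^ n = 1} = (\<Union>d\<in>{d. d dvd n}. primitive_roots_unity d)"
proof (intro equalityI subsetI)
  fix z :: complex
  assume z: "z \<in> {z. z ^ n = 1}"
  define d where "d = (LEAST d. d > 0 \<and> z ^ d = 1)"
  have d: "d > 0 \<and> z ^ d = 1"
    unfolding d_def by (rule LeastI[of _ n]) (use z assms in auto)
  have "z \<in> primitive_roots_unity d"
    using d not_less_Least[of _ "\<lambda>d. d > 0 \<and> z ^ d = 1"]
    unfolding primitive_roots_unity_def d_def by auto
  thus "z \<in> (\<Union>d\<in>{d. d dvd n}. primitive_roots_unity d)"
    using primitive_root_power_eq_1_iff[of d z n] d z by auto
next
  fix z :: complex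
  assume "z \<in> (\<Union>d\<in>{d. d dvd n}. primitive_roots_unity d)"
  then obtain d where "d dvd n" "z \<in> primitive_roots_unity d" by auto
  thus "z \<in> {z. z ^ n = 1}"
    by (auto simp: primitive_roots_unity_def power_mult)
qed

lemma finite_primitive_roots_unity:
  assumes "n > 0"
  shows "finite (primitive_roots_unity n)"
  by (rule finite_subset[of _ "{z::complex. z ^ n = 1}"])
     (use assms finite_roots_unity[of n] in \<open>auto simp: primitive_roots_unity_def\<close>)

lemma card_primitive_roots_unity:
  assumes "n > 0"
  shows "card (primitive_roots_unity n) = totient n"
  using assms
proof (induction n rule: less_induct)
  case (less n)
  let ?D = "{d. d dvd n}"
  have fin: "finite ?D" using less.prems by simp
  have pos: "d > 0" if "d \<in> ?D" for d
    using that less.prems by (auto intro!: Nat.gr0I)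
  have "n = card {z::complex. z ^ n = 1}"
    using card_roots_unity_eq[of n] less.prems by simp
  also have "\<dots> = (\<Sum>d\<in>?D. card (primitive_roots_unity d))"
    unfolding roots_unity_eq_Union[OF less.prems]
    by (rule card_UN_disjoint)
       (use fin pos disjoint_primitive_roots_unity finite_primitive_roots_unity in auto)
  also have "\<dots> = card (primitive_roots_unity n) + (\<Sum>d\<in>?D - {n}. card (primitive_roots_unity d))"
    using fin by (subst sum.remove[of _ n]) auto
  also have "(\<Sum>d\<in>?D - {n}. card (primitive_roots_unity d)) = (\<Sum>d\<in>?D - {n}. totient d)"
  proof (rule sum.cong)
    fix d assume d: "d \<in> ?D - {n}"
    hence "d < n" using less.prems by (auto dest: dvd_imp_le)
    thus "card (primitive_roots_unity d) = totient d"
      using less.IH pos d by auto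
  qed auto
  finally have "n = card (primitive_roots_unity n) + (\<Sum>d\<in>?D - {n}. totient d)" .
  moreover have "n = totient n + (\<Sum>d\<in>?D - {n}. totient d)"
    using fin totient_divisor_sum[of n] by (subst (asm) sum.remove[of _ n]) auto
  ultimately show ?case by linarith
qed

lemma lead_coeff_prod_linear: "lead_coeff (\<Prod>z\<in>S. [:-z, 1::complex:]) = 1"
  by (simp add: lead_coeff_prod)

lemma degree_prod_linear: "degree (\<Prod>z\<in>S. [:-z, 1::complex:]) = card S"
  by (subst degree_prod_eq_sum_degree) auto

lemma prod_roots_unity:
  assumes "n > 0"
  shows "(\<Prod>z | z ^ n = 1. [:-z, 1::complex:]) = monom 1 n - 1"
proof (rule ccontr)
  let ?S = "{z::complex. z ^ n = 1}"
  let ?p = "\<Prod>z\<in>?S. [:-z, 1:]" and ?q = "monom 1 n - 1 :: complex poly"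
  assume ne: "?p \<noteq> ?q"
  have card: "card ?S = n" and fin: "finite ?S"
    using card_roots_unity_eq[of n] finite_roots_unity[of n] assms by auto
  have degp: "degree ?p = n"
    using card by (simp only: degree_prod_linear)
  have "degree (?p - ?q) \<le> n"
    by (intro degree_diff_le) (use degp in \<open>auto simp: degree_monom_eq\<close>)
  moreover have "coeff (?p - ?q) n = 0"
    using lead_coeff_prod_linear[of ?S] degp assms by simp
  ultimately have "degree (?p - ?q) < n"
    using ne by (metis eq_iff_diff_eq_0 leading_coeff_0_iff le_neq_implies_less)
  moreover have "?S \<subseteq> {z. poly (?p - ?q) z = 0}"
    using fin by (auto simp: poly_prod poly_monom prod_zero_iff)
  hence "n \<le> card {z. poly (?p - ?q) z = 0}"
    using card ne by (metis card_mono poly_roots_finite right_minus_eq)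
  moreover have "card {z. poly (?p - ?q) z = 0} \<le> degree (?p - ?q)"
    using ne by (intro card_poly_roots_bound) auto
  ultimately show False by linarith
qed

lemma map_poly_of_int_add:
  "map_poly (of_int :: int \<Rightarrow> 'a::comm_ring_1) (p + q) = map_poly of_int p + map_poly of_int q"
  by (rule poly_eqI) (simp add: coeff_map_poly)

lemma map_poly_of_int_mult:
  "map_poly (of_int :: int \<Rightarrow> 'a::comm_ring_1) (p * q) = map_poly of_int p * map_poly of_int q"
  by (rule poly_eqI) (simp add: coeff_map_poly coeff_mult)

lemma ex1_cyclotomic:
  assumes "k > 0"
  shows "\<exists>!P::int poly. map_poly of_int P = (\<Prod>z\<in>primitive_roots_unity k. [:-z, 1:])"
proof (rule ex_ex1I)
  show "\<exists>P::int poly. map_poly of_int P = (\<Prod>z\<in>primitive_roots_unity k. [:-z, 1:])"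
    using assms
  proof (induction k rule: less_induct)
    case (less k)
    let ?c = "\<lambda>d. \<Prod>z\<in>primitive_roots_unity d. [:-z, 1:]"
    let ?D = "{d. d dvd k} - {k}"
    have pos: "d > 0" if "d dvd k" for d
      using that less.prems by (auto intro!: Nat.gr0I)
    have ex: "\<forall>d\<in>?D. \<exists>P::int poly. map_poly of_int P = ?c d"
    proof
      fix d assume d: "d \<in> ?D"
      have "d < k"
        using d dvd_imp_le[of d k] less.prems by simp
      thus "\<exists>P::int poly. map_poly of_int P = ?c d"
        using d pos[of d] by (intro less.IH) simp_all
    qed
    obtain P :: "nat \<Rightarrow> int poly" where P: "\<forall>d\<in>?D. map_poly of_int (P d) = ?c d"
      using bchoice[OF ex] by (elim exE)
    define B where "B = (\<Prod>d\<in>?D. P d)"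
    have map_prod: "map_poly of_int (\<Prod>d\<in>S. P d) = (\<Prod>d\<in>S. map_poly of_int (P d) :: complex poly)"
      for S by (induction S rule: infinite_finite_induct) (simp_all add: map_poly_of_int_mult)
    have B: "map_poly of_int B = (\<Prod>d\<in>?D. ?c d)"
      unfolding B_def map_prod using P by (intro prod.cong) auto
    have "(\<Prod>d\<in>{d. d dvd k}. ?c d) = monom 1 k - 1"
      unfolding prod_roots_unity[OF less.prems, symmetric] roots_unity_eq_Union[OF less.prems]
      by (rule prod.UNION_disjoint[symmetric])
         (use less.prems pos disjoint_primitive_roots_unity finite_primitive_roots_unity in auto)
    hence eq: "?c k * map_poly of_int B = monom 1 k - 1"
      unfolding B using less.prems by (subst (asm) prod.remove[of _ k]) auto
    have degB: "degree (map_poly of_int B :: complex poly) = degree B"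
      by (intro degree_map_poly) auto
    have "lead_coeff (map_poly of_int B :: complex poly) = 1"
      unfolding B by (subst lead_coeff_prod) (simp only: lead_coeff_prod_linear prod.neutral_const)
    hence lcB: "lead_coeff B = 1"
      unfolding degB by (simp add: coeff_map_poly)
    hence "B \<noteq> 0" by auto
    obtain Q R where QR: "pseudo_divmod (monom 1 k - 1) B = (Q, R)"
      by fastforce
    have F: "monom 1 k - 1 = B * Q + R" and R: "R = 0 \<or> degree R < degree B"
      using pseudo_divmod[OF \<open>B \<noteq> 0\<close> QR] lcB by auto
    have "map_poly of_int (monom 1 k - 1) = (monom 1 k - 1 :: complex poly)"
      by (rule poly_eqI) (simp add: coeff_map_poly)
    moreover have "map_poly of_int (B * Q + R) =
        (map_poly of_int B * map_poly of_int Q + map_poly of_int R :: complex poly)"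
      by (simp add: map_poly_of_int_add map_poly_of_int_mult)
    ultimately have "?c k * map_poly of_int B =
        map_poly of_int B * map_poly of_int Q + map_poly of_int R"
      using eq F by (simp only:)
    hence F': "(?c k - map_poly of_int Q) * map_poly of_int B = map_poly of_int R"
      by (simp add: algebra_simps)
    have "?c k - map_poly of_int Q = 0"
    proof (rule ccontr)
      assume ne: "?c k - map_poly of_int Q \<noteq> 0"
      have "map_poly of_int B \<noteq> (0 :: complex poly)"
        using \<open>B \<noteq> 0\<close> by (simp add: map_poly_eq_0_iff)
      with ne have nz: "map_poly of_int R \<noteq> (0 :: complex poly)"
        by (simp flip: F')
      have "degree (map_poly of_int R :: complex poly) = degree R"
        by (intro degree_map_poly) auto
      moreover have "degree (map_poly of_int R :: complex poly) \<ge> degree B"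
        unfolding F'[symmetric] degB[symmetric] using ne \<open>map_poly of_int B \<noteq> 0\<close>
        by (subst degree_mult_eq) auto
      ultimately show False using R nz by auto
    qed
    thus ?case by auto
  qed
next
  fix P Q :: "int poly"
  assume "map_poly of_int P = (\<Prod>z\<in>primitive_roots_unity k. [:-z, 1:])"
    and "map_poly of_int Q = (\<Prod>z\<in>primitive_roots_unity k. [:-z, 1:])"
  hence "map_poly of_int P = (map_poly of_int Q :: complex poly)" by simp
  thus "P = Q"
    by (simp add: poly_eq_iff coeff_map_poly)
qed

lemma map_poly_cyclotomic:
  assumes "k > 0"
  shows "map_poly of_int (cyclotomic k) = (\<Prod>z\<in>primitive_roots_unity k. [:-z, 1:])"
  unfolding cyclotomic_def by (rule theI'[OF ex1_cyclotomic[OF assms]])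

lemma degree_cyclotomic:
  assumes "k > 0"
  shows "degree (cyclotomic k) = totient k"
proof -
  have "degree (cyclotomic k) = degree (map_poly of_int (cyclotomic k) :: complex poly)"
    by (rule degree_map_poly[symmetric]) auto
  thus ?thesis
    using assms by (simp only: map_poly_cyclotomic degree_prod_linear card_primitive_roots_unity)
qed

lemma lead_coeff_cyclotomic:
  assumes "k > 0"
  shows "lead_coeff (cyclotomic k) = 1"
proof -
  have "of_int (lead_coeff (cyclotomic k)) = lead_coeff (map_poly of_int (cyclotomic k) :: complex poly)"
    by (subst degree_map_poly) (auto simp: coeff_map_poly)
  also have "\<dots> = 1"
    using assms by (simp only: map_poly_cyclotomic lead_coeff_prod_linear)
  finally show ?thesis by simp
qed

lemma cyclotomic_rat_nonzero:
  assumes "k > 0"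
  shows "cyclotomic_rat k \<noteq> 0"
proof -
  have "cyclotomic k \<noteq> 0"
    using lead_coeff_cyclotomic[OF assms] by auto
  thus ?thesis
    by (simp add: map_poly_eq_0_iff)
qed

lemma poly_cyclotomic_eq_0_iff:
  assumes "k > 0"
  shows "poly (map_poly of_int (cyclotomic k)) z = 0 \<longleftrightarrow> z \<in> primitive_roots_unity k"
  unfolding map_poly_cyclotomic[OF assms]
  using finite_primitive_roots_unity[OF assms] by (auto simp: poly_prod prod_zero_iff)

lemma coprime_cyclotomic_rat:
  assumes "m > 0" "n > 0" "m \<noteq> n"
  shows "coprime (cyclotomic_rat m) (cyclotomic_rat n)"
proof (rule coprimeI)
  fix d :: "rat poly"
  assume d: "d dvd cyclotomic_rat m" "d dvd cyclotomic_rat n"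
  let ?h = "map_poly (of_rat :: rat \<Rightarrow> complex)"
  have h_mult: "?h (p * q) = ?h p * ?h q" for p q
    by (rule poly_eqI) (simp add: coeff_map_poly coeff_mult of_rat_sum of_rat_mult)
  have h_cyc: "?h (cyclotomic_rat k) = map_poly of_int (cyclotomic k)" for k
    by (rule poly_eqI) (simp add: coeff_map_poly)
  have root: "z \<in> primitive_roots_unity k"
    if "k > 0" "d dvd cyclotomic_rat k" "poly (?h d) z = 0" for k z
    using that by (auto elim!: dvdE simp: h_mult simp flip: poly_cyclotomic_eq_0_iff h_cyc)
  have "\<nexists>z. poly (?h d) z = 0"
    using root[OF assms(1) d(1)] root[OF assms(2) d(2)] disjoint_primitive_roots_unity[OF assms]
    by blast
  hence "constant (poly (?h d))"
    using fundamental_theorem_of_algebra by blast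
  hence "degree (?h d) = 0"
    by (simp add: constant_degree)
  hence "degree d = 0"
    by (subst (asm) degree_map_poly) auto
  moreover have "d \<noteq> 0"
    using d(1) cyclotomic_rat_nonzero[OF assms(1)] by auto
  ultimately show "is_unit d"
    by (simp add: is_unit_iff_degree)
qed

lemma ex1_cyclotomic_inv_mod:
  assumes "m > 0" "n > 0" "m \<noteq> n"
  shows "\<exists>!U. degree U < totient n \<and> [cyclotomic_rat m * U = 1] (mod cyclotomic_rat n)"
proof (rule ex_ex1I)
  let ?f = "cyclotomic_rat m" and ?g = "cyclotomic_rat n"
  have deg: "degree ?g = totient n"
    using degree_cyclotomic[OF assms(2)] by (subst degree_map_poly) auto
  have "?g \<noteq> 0"
    by (rule cyclotomic_rat_nonzero[OF assms(2)])
  obtain U V where "U * ?f + V * ?g = 1"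
    using coprime_cyclotomic_rat[OF assms] bezout_coefficients[of ?f ?g]
    by (metis coprime_imp_gcd_eq_1 surj_pair)
  hence "[?f * U = 1] (mod ?g)"
    by (metis add_diff_cancel_left' cong_iff_dvd_diff cong_sym dvd_triv_right mult.commute)
  hence "[?f * (U mod ?g) = 1] (mod ?g)"
    by (simp add: cong_def mod_mult_right_eq)
  moreover have "degree (U mod ?g) < totient n"
    using degree_mod_less[OF \<open>?g \<noteq> 0\<close>, of U] deg assms(2) by auto
  ultimately show "\<exists>U. degree U < totient n \<and> [?f * U = 1] (mod ?g)" by blast
  fix U V
  assume U: "degree U < totient n \<and> [?f * U = 1] (mod ?g)"
    and V: "degree V < totient n \<and> [?f * V = 1] (mod ?g)"
  hence "[?f * U = ?f * V] (mod ?g)"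
    by (auto simp: cong_def)
  hence "?g dvd ?f * (U - V)"
    by (simp add: cong_iff_dvd_diff algebra_simps)
  hence "?g dvd U - V"
    using coprime_cyclotomic_rat[OF assms] by (simp add: coprime_dvd_mult_right_iff coprime_commute)
  moreover have "degree (U - V) < degree ?g"
    using U V deg by (simp add: degree_diff_less)
  ultimately have "U - V = 0"
    by (meson dvd_imp_degree_le linorder_not_le)
  thus "U = V" by simp
qed

lemma cyclotomic_inv_mod:
  assumes "m > 0" "n > 0" "m \<noteq> n"
  shows "degree (cyclotomic_inv_mod m n) < totient n"
    and "[cyclotomic_rat m * cyclotomic_inv_mod m n = 1] (mod cyclotomic_rat n)"
  using theI'[OF ex1_cyclotomic_inv_mod[OF assms]] unfolding cyclotomic_inv_mod_def by auto

end

theory Submission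
  imports Defs
begin

text \<open>
  The only input about cyclotomic polynomials is
  \<open>\<Phi>\<^sub>p = 1 + X + \<dots> + X\<^bsup>p-1\<^esup>\<close> and \<open>\<Phi>\<^sub>p\<^sub>r \<Phi>\<^sub>p = \<Sum>\<^sub>b\<^sub><\<^sub>p X\<^bsup>rb\<^esup>\<close>.
  A Bezout identity \<open>\<Phi>\<^sub>m U + \<Phi>\<^sub>n W = 1\<close> with \<open>deg W < \<phi>(m)\<close> determines both inverses, and
  \<open>W\<close> is explicit in each case: \<open>1/p\<close> for \<open>(1, p)\<close>, \<open>1\<close> for \<open>(1, pr)\<close>, and
  \<open>(1 + \<dots> + X\<^bsup>s-1\<^esup>)/r\<close> with \<open>s = r mod p\<close> for \<open>(p, pr)\<close>. Expanding
  \<open>U = (1 - \<Phi>\<^sub>n W)/\<Phi>\<^sub>m\<close> as a power series turns its coefficients into counts of exponents in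
  a residue class modulo \<open>p\<close>, which the coprimality of \<open>p\<close> and \<open>r\<close> bounds.
  Modulo \<open>\<Phi>\<^sub>r\<close>, if \<open>p p' \<equiv> 1 (mod r)\<close>, then \<open>\<Sum>\<^sub>i\<^sub><\<^sub>p\<^sub>' X\<^bsup>pi mod r\<^esup>\<close> is an inverse of \<open>\<Phi>\<^sub>p\<close> with
  coefficients \<open>0\<close> and \<open>1\<close>, and the reduction subtracts at most one copy of \<open>\<Phi>\<^sub>r\<close>.
\<close>

section \<open>Powers of X, geometric sums and their congruences\<close>

definition qX :: "rat poly" where "qX = monom 1 1"

lemma qX_power: "qX ^ n = monom 1 n"
  by (induction n) (simp_all add: qX_def monom_0 mult_monom)

lemma coeff_qX_power: "coeff (qX ^ n) i = (if i = n then 1 else 0)"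
  by (simp add: qX_power)

lemma poly_qX: "poly qX x = x"
  by (simp add: qX_def poly_monom)

lemma qX_power_neq_1:
  assumes "n > 0"
  shows "qX ^ n \<noteq> 1"
proof
  assume "qX ^ n = 1"
  hence "coeff (qX ^ n) n = coeff 1 n" by simp
  thus False using assms by (simp add: coeff_qX_power)
qed

lemma qX_neq_1: "qX \<noteq> 1"
  using qX_power_neq_1[of 1] by simp

lemma qX_minus_1: "qX - 1 = [:- 1, 1:]"
  by (simp add: qX_def monom_altdef one_pCons)

lemma fps_of_poly_qX: "fps_of_poly qX = fps_X"
  using fps_of_poly_monom'[of 1] by (simp add: qX_def)

lemma fps_of_poly_of_nat: "fps_of_poly (of_nat n) = of_nat n"
  by (induction n) (simp_all add: fps_of_poly_add)

definition geom :: "nat \<Rightarrow> rat poly" where "geom n = (\<Sum>i<n. qX ^ i)"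

lemma geom_mult: "(qX - 1) * geom n = qX ^ n - 1"
  unfolding geom_def by (rule power_diff_1_eq[symmetric])

lemma geom_power_mult: "(qX ^ a - 1) * (\<Sum>i<b. qX ^ (a * i)) = qX ^ (a * b) - 1"
  using power_diff_1_eq[of "qX ^ a" b] by (simp add: power_mult)

lemma geom_product: "geom a * (\<Sum>i<b. qX ^ (a * i)) = geom (a * b)"
proof -
  have "(qX - 1) * (geom a * (\<Sum>i<b. qX ^ (a * i))) = (qX - 1) * geom (a * b)"
    by (simp only: geom_mult geom_power_mult mult.assoc[symmetric])
  thus ?thesis using qX_neq_1 by simp
qed

lemma coeff_geom: "coeff (geom n) i = (if i < n then 1 else 0)"
  by (simp add: geom_def coeff_sum coeff_qX_power)

lemma degree_geom_le: "degree (geom n) \<le> n - 1"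
  by (rule degree_le) (auto simp: coeff_geom)

lemma poly_geom_1: "poly (geom n) 1 = of_nat n"
  by (simp add: geom_def poly_sum poly_qX)

lemma sum_monom_eq_geom: "(\<Sum>i = 0..d. monom 1 i) = geom (Suc d)"
  by (simp add: geom_def qX_power lessThan_Suc_atMost atMost_atLeast0)

lemma power_diff_dvd: "x ^ n - 1 dvd x ^ (n * k) - (1 :: 'a :: comm_ring_1)"
  using power_diff_1_eq[of "x ^ n" k] by (simp add: power_mult)

lemma power_cong:
  assumes "[a = b] (mod n)"
  shows "[qX ^ a = qX ^ b] (mod (qX ^ n - 1))"
proof -
  have *: "[qX ^ m = qX ^ (m mod n)] (mod (qX ^ n - 1))" for m
  proof -
    have "qX ^ m - qX ^ (m mod n) = qX ^ (m mod n) * (qX ^ (n * (m div n)) - 1)"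
      by (simp add: algebra_simps flip: power_add)
    thus ?thesis
      by (simp add: cong_iff_dvd_diff power_diff_dvd)
  qed
  show ?thesis
    using *[of a] *[of b] assms by (simp add: cong_def)
qed

lemma geom_dvd: "geom n dvd qX ^ n - 1"
  by (metis geom_mult dvd_triv_right)

text \<open>This is \<open>power_cong\<close> divided by the common factor X - 1.\<close>

lemma geom_cong:
  assumes "[a = b] (mod n)"
  shows "[geom a = geom b] (mod geom n)"
proof -
  have "(qX - 1) * geom n dvd (qX - 1) * (geom a - geom b)"
    using power_cong[OF assms] by (simp add: cong_iff_dvd_diff geom_mult right_diff_distrib)
  thus ?thesis
    using qX_neq_1 by (simp add: cong_iff_dvd_diff)
qed

section \<open>Explicit cyclotomic polynomials at p and p r\<close>

text \<open>Over the complex numbers both sides are the product of X - z over all n-th roots of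
  unity, grouped by exact order on the left. The embedding of the integers is injective, so the
  identity descends to integer polynomials and then passes to rational ones.\<close>

lemma prod_cyclotomic_rat:
  assumes "n > 0"
  shows "(\<Prod>d | d dvd n. cyclotomic_rat d) = qX ^ n - 1"
proof -
  have map_prod: "map_poly of_int (\<Prod>d\<in>S. P d) =
      (\<Prod>d\<in>S. map_poly of_int (P d) :: 'a :: comm_ring_1 poly)" for S :: "nat set" and P
    by (induction S rule: infinite_finite_induct) (simp_all add: map_poly_of_int_mult)
  have map_X: "map_poly of_int (monom 1 n - 1) = (monom 1 n - 1 :: 'a :: comm_ring_1 poly)"
    by (rule poly_eqI) (simp add: coeff_map_poly)
  have pos: "d > 0" if "d dvd n" for d
    using that assms by (auto intro!: Nat.gr0I)
  have "map_poly of_int (\<Prod>d | d dvd n. cyclotomic d) =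
      (\<Prod>d | d dvd n. \<Prod>z\<in>primitive_roots_unity d. [:-z, 1:])"
    unfolding map_prod using pos map_poly_cyclotomic by (intro prod.cong) auto
  also have "\<dots> = monom 1 n - 1"
    unfolding prod_roots_unity[OF assms, symmetric] roots_unity_eq_Union[OF assms]
    by (rule prod.UNION_disjoint[symmetric])
       (use assms pos disjoint_primitive_roots_unity finite_primitive_roots_unity in auto)
  also have "\<dots> = map_poly of_int (monom 1 n - 1)"
    by (rule map_X[symmetric])
  finally have "of_int (coeff (\<Prod>d | d dvd n. cyclotomic d) i) =
      (of_int (coeff (monom 1 n - 1) i) :: complex)" for i
    by (metis coeff_map_poly of_int_0)
  hence "(\<Prod>d | d dvd n. cyclotomic d) = monom 1 n - 1"
    by (intro poly_eqI) (simp only: of_int_eq_iff)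
  from arg_cong[OF this, of "map_poly of_int :: int poly \<Rightarrow> rat poly"] show ?thesis
    by (simp add: map_prod map_X qX_power)
qed

lemma cyclotomic_rat_1: "cyclotomic_rat (Suc 0) = qX - 1"
  using prod_cyclotomic_rat[of 1] by simp

lemma cyclotomic_rat_prime:
  assumes "prime p"
  shows "cyclotomic_rat p = geom p"
proof -
  have "{d. d dvd p} = {1, p}" "p \<noteq> 1" "p > 0"
    using assms by (auto simp: prime_nat_iff)
  hence "(qX - 1) * cyclotomic_rat p = (qX - 1) * geom p"
    using prod_cyclotomic_rat[of p] cyclotomic_rat_1 by (simp add: geom_mult)
  thus ?thesis
    using qX_neq_1 by simp
qed

lemma divisors_prime_product:
  fixes p r :: nat
  assumes "prime p" "prime r"
  shows "{d. d dvd p * r} = {1, p, r, p * r}"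
proof (intro equalityI subsetI)
  fix d assume "d \<in> {d. d dvd p * r}"
  then obtain a b where "d = a * b" "a dvd p" "b dvd r"
    by (auto elim: dvd_productE)
  moreover have "a = 1 \<or> a = p" "b = 1 \<or> b = r"
    using assms \<open>a dvd p\<close> \<open>b dvd r\<close> by (simp_all only: prime_nat_iff)
  ultimately show "d \<in> {1, p, r, p * r}"
    by auto
qed auto

lemma cyclotomic_rat_prime_product:
  assumes "prime p" "prime r" "p \<noteq> r"
  shows "cyclotomic_rat (p * r) * geom p = (\<Sum>b<p. qX ^ (r * b))"
proof -
  have gt: "p > 1" "r > 1"
    using assms by (simp_all only: prime_gt_1_nat)
  hence "(\<Prod>d | d dvd p * r. cyclotomic_rat d) =
      cyclotomic_rat 1 * cyclotomic_rat p * cyclotomic_rat r * cyclotomic_rat (p * r)"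
    unfolding divisors_prime_product[OF assms(1,2)] using assms(3) by (simp add: mult.assoc)
  \<comment> \<open>Phi_1 Phi_r = X^r - 1 absorbs two of the four factors.\<close>
  hence "(qX ^ r - 1) * (cyclotomic_rat (p * r) * geom p) = qX ^ (r * p) - 1"
    using prod_cyclotomic_rat[of "p * r"] gt assms
    by (simp add: cyclotomic_rat_1 cyclotomic_rat_prime geom_mult ac_simps
        flip: geom_mult[of r])
  hence "(qX ^ r - 1) * (cyclotomic_rat (p * r) * geom p) = (qX ^ r - 1) * (\<Sum>b<p. qX ^ (r * b))"
    by (simp only: geom_power_mult)
  thus ?thesis
    using qX_power_neq_1[of r] gt by simp
qed

text \<open>With p and r exchanged, Phi_pr Phi_r is a sum of r powers of X^p, each congruent to 1
  modulo X^p - 1, a multiple of Phi_p.\<close>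

lemma cyclotomic_rat_prime_product_cong:
  assumes "prime p" "prime r" "p \<noteq> r"
  shows "[cyclotomic_rat (p * r) * geom r = of_nat r] (mod geom p)"
proof -
  have "cyclotomic_rat (p * r) * geom r = (\<Sum>b<r. qX ^ (p * b))"
    using cyclotomic_rat_prime_product[of r p] assms by (simp add: mult.commute)
  moreover have "[(\<Sum>b<r. qX ^ (p * b)) = (\<Sum>b<r. qX ^ 0)] (mod qX ^ p - 1)"
    by (intro cong_sum power_cong) (simp add: cong_def)
  ultimately show ?thesis
    using geom_dvd[of p] by (auto intro: cong_dvd_modulus)
qed

section \<open>From a Bezout identity to both inverses\<close>

lemma degree_cyclotomic_rat: "n > 0 \<Longrightarrow> degree (cyclotomic_rat n) = totient n"
  using degree_cyclotomic[of n] by (subst degree_map_poly) auto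

lemma cyclotomic_inv_mod_eqI:
  assumes "m > 0" "n > 0" "m \<noteq> n"
    and "degree U < totient n" "[cyclotomic_rat m * U = 1] (mod cyclotomic_rat n)"
  shows "cyclotomic_inv_mod m n = U"
  unfolding cyclotomic_inv_mod_def
  by (rule the1_equality[OF ex1_cyclotomic_inv_mod[OF assms(1-3)]]) (use assms in simp)

text \<open>Phi_m U = 1 - Phi_n W has degree below phi(n) + phi(m), which gives deg U < phi(n); only
  W has to be bounded by hand.\<close>

lemma cyclotomic_bezout:
  assumes "m > 0" "n > 0" "m \<noteq> n"
    and eq: "cyclotomic_rat m * U + cyclotomic_rat n * W = 1" and "degree W < totient m"
  shows "cyclotomic_inv_mod m n = U" "cyclotomic_inv_mod n m = W"
proof -
  have "degree U < totient n"
  proof (cases "U = 0")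
    case False
    have "totient m + degree U = degree (cyclotomic_rat m * U)"
      using False assms(1) by (simp add: degree_mult_eq cyclotomic_rat_nonzero degree_cyclotomic_rat)
    also have "cyclotomic_rat m * U = 1 - cyclotomic_rat n * W"
      using eq by (simp add: algebra_simps)
    also have "degree \<dots> \<le> totient n + degree W"
      using degree_mult_le[of "cyclotomic_rat n" W] assms(2)
      by (intro degree_diff_le) (simp_all add: degree_cyclotomic_rat)
    finally show ?thesis using assms(5) by simp
  qed (use assms(2) in simp)
  moreover from eq have "cyclotomic_rat m * U - 1 = - (cyclotomic_rat n * W)"
    "cyclotomic_rat n * W - 1 = - (cyclotomic_rat m * U)"
    by (simp_all add: algebra_simps)
  hence "[cyclotomic_rat m * U = 1] (mod cyclotomic_rat n)"
    "[cyclotomic_rat n * W = 1] (mod cyclotomic_rat m)"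
    by (simp_all only: cong_iff_dvd_diff) simp_all
  ultimately show "cyclotomic_inv_mod m n = U" "cyclotomic_inv_mod n m = W"
    using assms by (auto intro!: cyclotomic_inv_mod_eqI)
qed

text \<open>Passes from coefficients to the existential form of the theorem. The degree bound forces
  t > 0, so the indices 0..t - 1 are exactly those below t.\<close>

lemma poly_eq_sum_of_int_monoms:
  fixes U :: "rat poly"
  assumes "degree U < t" "\<And>i. i < t \<Longrightarrow> \<exists>k::int. coeff U i = of_int k \<and> P k"
  shows "\<exists>v :: nat \<Rightarrow> int. U = (\<Sum>i = 0..t - 1. monom (of_int (v i)) i) \<and> (\<forall>i\<in>{0..t - 1}. P (v i))"
proof -
  from assms(2) obtain v :: "nat \<Rightarrow> int" where v: "\<And>i. i < t \<Longrightarrow> coeff U i = of_int (v i) \<and> P (v i)"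
    by metis
  have "U = (\<Sum>i\<le>t - 1. monom (coeff U i) i)"
    using assms(1) by (intro poly_as_sum_of_monoms'[symmetric]) simp
  also have "\<dots> = (\<Sum>i = 0..t - 1. monom (of_int (v i)) i)"
    using v assms(1) by (intro sum.cong) auto
  finally show ?thesis
    using v assms(1) by (intro exI[of _ v]) auto
qed

section \<open>Division by 1 - X^p as a power series\<close>

text \<open>The power series 1/(1 - X^p) for p > 0.\<close>

definition fps_multiples :: "nat \<Rightarrow> rat fps" where
  "fps_multiples p = Abs_fps (\<lambda>n. if p dvd n then 1 else 0)"

lemma fps_multiples_inverse:
  assumes "p > 0"
  shows "(1 - fps_X ^ p) * fps_multiples p = 1"
proof (rule fps_ext)
  fix n
  have "p dvd n \<longleftrightarrow> p dvd n - p" if "p \<le> n"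
    using that by (metis dvd_diff_nat dvd_refl dvd_diffD)
  moreover have "p dvd n \<longleftrightarrow> n = 0" if "n < p"
    using that by (auto dest: dvd_imp_le)
  ultimately show "fps_nth ((1 - fps_X ^ p) * fps_multiples p) n = fps_nth 1 n"
    using assms by (auto simp: left_diff_distrib fps_X_power_mult_nth fps_multiples_def)
qed

lemma fps_mult_multiples_cancel:
  assumes "p > 0" "A * (1 - fps_X ^ p) = B"
  shows "A = B * fps_multiples p"
  using fps_multiples_inverse[OF assms(1)] assms(2) by (metis mult.assoc mult.right_neutral)

text \<open>X^e/(1 - X^p) = X^e + X^(e+p) + ..., so degree n collects one unit from each exponent
  that reaches n in steps of p.\<close>

lemma nth_sum_power_mult_multiples:
  assumes "finite B"
  shows "fps_nth ((\<Sum>b\<in>B. fps_X ^ e b) * fps_multiples p) n =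
    of_nat (card {b \<in> B. e b \<le> n \<and> p dvd n - e b})"
proof -
  have "fps_nth ((\<Sum>b\<in>B. fps_X ^ e b) * fps_multiples p) n =
      (\<Sum>b\<in>B. if e b \<le> n \<and> p dvd n - e b then 1 else 0)"
    unfolding sum_distrib_right fps_sum_nth
    by (intro sum.cong) (auto simp: fps_X_power_mult_nth fps_multiples_def)
  thus ?thesis
    using assms by (simp flip: sum.inter_filter)
qed

section \<open>Inverses for the pairs (1, p) and (1, p r)\<close>

lemma inverses_prime_1:
  assumes "prime p"
  shows "cyclotomic_inv_mod p 1 = [:1 / of_nat p:]"
    "cyclotomic_inv_mod 1 p =
       smult (- (1 / of_nat p)) (\<Sum>k = 0..p - 2. monom (of_nat p - 1 - of_nat k) k)"
proof -
  have p: "p > 1"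
    using assms by (simp only: prime_gt_1_nat)
  define S where "S = (\<Sum>k = 0..p - 2. monom (of_nat p - 1 - of_nat k :: rat) k)"
  \<comment> \<open>The value p - 1 - i vanishes at i = p - 1, so the formula extends from i \<le> p
    - 2 to all i < p.\<close>
  have S: "coeff S i = (if i < p then of_nat p - 1 - of_nat i else 0)" for i
  proof -
    have "i = p - 1" if "i < p" "\<not> i \<le> p - 2"
      using that by simp
    thus ?thesis
      using p by (auto simp: S_def coeff_sum of_nat_diff)
  qed
  \<comment> \<open>Consecutive coefficients of S drop by 1, and the constant term of the product is
    -(p - 1) = 1 - p.\<close>
  have "coeff ((qX - 1) * S) i = coeff (geom p - of_nat p) i" for i
  proof (cases i)
    case 0
    thus ?thesis using p
      by (simp add: left_diff_distrib qX_def coeff_monom_mult S coeff_geom of_nat_poly)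
  next
    case (Suc j)
    thus ?thesis using p
      by (auto simp: left_diff_distrib qX_def coeff_monom_mult S coeff_geom of_nat_poly)
  qed
  hence "(qX - 1) * S = geom p - of_nat p"
    by (rule poly_eqI)
  hence "cyclotomic_rat 1 * smult (- (1 / of_nat p)) S + cyclotomic_rat p * [:1 / of_nat p:] = 1"
    using p assms by (simp add: cyclotomic_rat_1 cyclotomic_rat_prime smult_diff_right of_nat_poly)
  from cyclotomic_bezout[OF _ _ _ this] p
  show "cyclotomic_inv_mod p 1 = [:1 / of_nat p:]"
    "cyclotomic_inv_mod 1 p =
       smult (- (1 / of_nat p)) (\<Sum>k = 0..p - 2. monom (of_nat p - 1 - of_nat k) k)"
    by (simp_all add: S_def)
qed

lemma card_le_1_if_inj:
  assumes "\<And>x y. x \<in> A \<Longrightarrow> y \<in> A \<Longrightarrow> x = y"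
  shows "card A \<le> 1"
  using assms by (metis card_le_Suc0_iff_eq card.infinite One_nat_def zero_le)

lemma cong_mult_left_bounded:
  fixes p r a b n :: nat
  assumes "coprime r p" "a < p" "b < p" "[r * a = r * b] (mod p)"
  shows "a = b"
  using assms cong_mult_lcancel_nat[of r p a b] by (metis cong_less_modulus_unique_nat)

lemma dvd_diff_cong:
  fixes a n p :: nat
  assumes "a \<le> n" "p dvd n - a"
  shows "[a = n] (mod p)"
  using assms by (metis cong_altdef_nat cong_sym)

text \<open>Since Phi_pr(1) = 1, the quotient U = (1 - Phi_pr)/(X - 1) is a polynomial, and W = 1
  completes the Bezout identity. Then U is the sum of X^(r b) - X^b over b < p, divided by 1 - X^p,
  so each coefficient is a count at most 1 minus a count equal to 1.\<close>

lemma inverses_prime_product_1: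
  assumes "prime p" "prime r" "p \<noteq> r"
  shows "cyclotomic_inv_mod (p * r) 1 = 1"
    and "coeff (cyclotomic_inv_mod 1 (p * r)) i \<in> {-1, 0}"
proof -
  have gt: "p > 1" "r > 1" and cop: "coprime r p"
    using assms by (simp_all only: prime_gt_1_nat primes_coprime)
  have key: "cyclotomic_rat (p * r) * geom p = (\<Sum>b<p. qX ^ (r * b))"
    by (rule cyclotomic_rat_prime_product[OF assms])
  from arg_cong[OF this, of "\<lambda>P. poly P 1"] have "poly (1 - cyclotomic_rat (p * r)) 1 = 0"
    using gt by (simp add: poly_geom_1 poly_sum poly_qX)
  hence "qX - 1 dvd 1 - cyclotomic_rat (p * r)"
    by (simp only: poly_eq_0_iff_dvd qX_minus_1)
  then obtain U where U: "1 - cyclotomic_rat (p * r) = (qX - 1) * U" ..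
  hence Phi: "cyclotomic_rat (p * r) = 1 - (qX - 1) * U"
    by (simp add: algebra_simps)
  hence "cyclotomic_rat 1 * U + cyclotomic_rat (p * r) * 1 = 1"
    by (simp add: cyclotomic_rat_1)
  note inv = cyclotomic_bezout[OF _ _ _ this]
  \<comment> \<open>The factor X - 1 turns \<open>geom p\<close> into X^p - 1, the denominator
    wanted below; it is cancelled again afterwards.\<close>
  have "(cyclotomic_rat (p * r) * geom p) * (qX - 1) = (1 - (qX - 1) * U) * (qX ^ p - 1)"
    by (simp add: mult_ac flip: geom_mult) (simp add: Phi mult_ac)
  hence "(qX - 1) * (\<Sum>b<p. qX ^ (r * b)) = (1 - (qX - 1) * U) * (qX ^ p - 1)"
    unfolding key by (simp only: mult.commute)
  also have "\<dots> = (qX - 1) * (U * (1 - qX ^ p)) + (qX - 1) * geom p"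
    unfolding geom_mult by (simp add: algebra_simps)
  finally have "(qX - 1) * (\<Sum>b<p. qX ^ (r * b)) = (qX - 1) * (U * (1 - qX ^ p) + geom p)"
    by (simp only: distrib_left)
  hence "U * (1 - qX ^ p) = (\<Sum>b<p. qX ^ (r * b)) - (\<Sum>b<p. qX ^ b)"
    using qX_neq_1 by (simp add: geom_def)
  from arg_cong[OF this, of fps_of_poly]
  have "fps_of_poly U * (1 - fps_X ^ p) = (\<Sum>b<p. fps_X ^ (r * b)) - (\<Sum>b<p. fps_X ^ b)"
    by (simp add: fps_of_poly_mult fps_of_poly_diff fps_of_poly_sum fps_of_poly_power fps_of_poly_qX)
  hence E: "fps_of_poly U =
      ((\<Sum>b<p. fps_X ^ (r * b)) - (\<Sum>b<p. fps_X ^ b)) * fps_multiples p"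
    using gt by (intro fps_mult_multiples_cancel) auto
  have "coeff U n \<in> {-1, 0}" for n
  proof -
    have "card {b \<in> {..<p}. r * b \<le> n \<and> p dvd n - r * b} \<le> 1"
      by (rule card_le_1_if_inj)
         (auto intro!: cong_mult_left_bounded[OF cop] dest!: dvd_diff_cong
           intro: cong_trans cong_sym)
    moreover have "card {b \<in> {..<p}. b \<le> n \<and> p dvd n - b} = 1"
    proof -
      \<comment> \<open>\<open>n mod p\<close> is the one b < p congruent to n, and it is at most
        n.\<close>
      have "{b \<in> {..<p}. b \<le> n \<and> p dvd n - b} = {n mod p}"
        using gt by (auto dest!: dvd_diff_cong simp: cong_def)
      thus ?thesis by simp
    qed
    moreover have "coeff U n = of_nat (card {b \<in> {..<p}. r * b \<le> n \<and> p dvd n - r * b}) -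
        of_nat (card {b \<in> {..<p}. b \<le> n \<and> p dvd n - b})"
      unfolding fps_of_poly_nth[symmetric] E
      by (simp only: left_diff_distrib fps_sub_nth nth_sum_power_mult_multiples finite_lessThan)
    ultimately show ?thesis
      by (auto simp: le_Suc_eq)
  qed
  with inv gt show "cyclotomic_inv_mod (p * r) 1 = 1"
    "coeff (cyclotomic_inv_mod 1 (p * r)) i \<in> {-1, 0}"
    by simp_all
qed

section \<open>The inverse of Phi_p modulo Phi_r\<close>

lemma inverse_mod_prime:
  assumes "prime p" "prime r" "p \<noteq> r"
  shows "coeff (cyclotomic_inv_mod p r) i \<in> {-1, 0, 1}"
proof -
  have gt: "p > 1" "r > 1" and cop: "coprime p r"
    using assms by (simp_all add: prime_gt_1_nat primes_coprime del: One_nat_def)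
  obtain x where "[p * x = 1] (mod r)"
    using cong_solve_coprime_nat[OF cop] by auto
  \<comment> \<open>Taking p' below r makes the exponents p i mod r pairwise distinct for i < p', so
    W has coefficients 0 and 1.\<close>
  then obtain p' where p': "[p * p' = 1] (mod r)" "p' < r"
    using gt that[of "x mod r"] by (simp add: cong_def mod_mult_right_eq)
  define W where "W = (\<Sum>i<p'. qX ^ (p * i mod r))"
  have coeff_W: "coeff W j = of_nat (card {i \<in> {..<p'}. p * i mod r = j})" for j
  proof -
    have "coeff W j = (\<Sum>i<p'. if p * i mod r = j then 1 else 0)"
      unfolding W_def coeff_sum by (intro sum.cong) (auto simp: coeff_qX_power)
    thus ?thesis by (simp flip: sum.inter_filter)
  qed
  have W01: "coeff W j \<in> {0, 1}" for j
  proof -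
    have "card {i \<in> {..<p'}. p * i mod r = j} \<le> 1"
      by (rule card_le_1_if_inj)
         (use p' in \<open>auto intro!: cong_mult_left_bounded[OF cop] simp: cong_def\<close>)
    hence "card {i \<in> {..<p'}. p * i mod r = j} = 0 \<or> card {i \<in> {..<p'}. p * i mod r = j} = 1"
      by linarith
    thus ?thesis
      unfolding coeff_W by (elim disjE) simp_all
  qed
  \<comment> \<open>X^(r-1) is the only power that can keep the degree of W from being below phi(r)
    = r - 1. Subtracting c Phi_r removes it and lowers the other coefficients below X^(r-1) by c
    \<in> {0, 1}.\<close>
  define c where "c = coeff W (r - 1)"
  define U where "U = W - smult c (geom r)"
  have U01: "coeff U j \<in> {-1, 0, 1}" for j
    using W01[of j] W01[of "r - 1"] by (auto simp: U_def c_def coeff_geom)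
  have "coeff U j = 0" if "j \<ge> r - 1" for j
  proof (cases "j = r - 1")
    case False
    hence "j \<ge> r"
      using that by simp
    moreover have "m mod r < r" for m
      using gt by simp
    ultimately have "{i \<in> {..<p'}. p * i mod r = j} = {}"
      by (metis (mono_tags, lifting) empty_Collect_eq linorder_not_le)
    thus ?thesis
      using that False gt by (simp add: U_def coeff_geom coeff_W)
  qed (use gt in \<open>simp add: U_def c_def coeff_geom\<close>)
  hence "degree U < totient r"
    using gt assms by (simp add: totient_prime degree_lessI)
  \<comment> \<open>Phi_p times the unreduced sum is \<open>geom (p * p')\<close>, congruent to
    \<open>geom 1 = 1\<close> because p p' is 1 modulo r.\<close>
  moreover have "[geom p * U = 1] (mod geom r)"
  proof -
    have "[W = (\<Sum>i<p'. qX ^ (p * i))] (mod qX ^ r - 1)"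
      unfolding W_def by (intro cong_sum power_cong) (simp add: cong_def)
    hence "[W = (\<Sum>i<p'. qX ^ (p * i))] (mod geom r)"
      using geom_dvd by (rule cong_dvd_modulus)
    hence "[U = (\<Sum>i<p'. qX ^ (p * i))] (mod geom r)"
      by (simp add: U_def cong_def mod_diff_eq[symmetric] mod_smult_left)
    hence "[geom p * U = geom p * (\<Sum>i<p'. qX ^ (p * i))] (mod geom r)"
      by (intro cong_mult cong_refl)
    also have "geom p * (\<Sum>i<p'. qX ^ (p * i)) = geom (p * p')"
      by (rule geom_product)
    also have "[geom (p * p') = geom 1] (mod geom r)"
      by (rule geom_cong[OF p'(1)])
    also have "geom 1 = 1"
      by (simp add: geom_def)
    finally show ?thesis .
  qed
  ultimately have "cyclotomic_inv_mod p r = U"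
    using gt assms by (intro cyclotomic_inv_mod_eqI) (simp_all add: cyclotomic_rat_prime)
  with U01 show ?thesis by simp
qed

section \<open>The pair (p, p r)\<close>

text \<open>Separates exponents by residue modulo p: those of T are multiples of p, those of N are
  congruent to r (c + 1) with 0 < c + 1 < p. Multiplication by X^p - 1 brings both sides to (X^s -
  1) times the sum of X^(r c) over c < p.\<close>

lemma cyclotomic_product_mult_geom_mod:
  fixes p r :: nat
  defines "q \<equiv> r div p" and "s \<equiv> r mod p"
  assumes "prime p" "prime r" "p \<noteq> r"
  shows "cyclotomic_rat (p * r) * geom s =
    (\<Sum>j<r - q. qX ^ (p * j)) - (\<Sum>(c, j)\<in>{..<p - 1} \<times> {..<q}. qX ^ (r * c + s + p * j))"
    (is "?L = ?T - ?N")
proof -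
  have gt: "p > 1" "r > 1"
    using assms by (simp_all add: prime_gt_1_nat del: One_nat_def)
  have r: "r = s + p * q" and qr: "q \<le> r"
    by (simp_all add: q_def s_def)
  have "(qX ^ p - 1) * ?N =
      (\<Sum>c<p - 1. qX ^ (r * c + s) * ((qX ^ p - 1) * (\<Sum>j<q. qX ^ (p * j))))"
    by (simp add: sum_distrib_left sum.cartesian_product power_add mult_ac case_prod_unfold)
  \<comment> \<open>As r = s + p q, the inner sum in powers of X^p telescopes between the exponents
    r c + s and r (c + 1).\<close>
  also have "\<dots> = (\<Sum>c<p - 1. qX ^ (r * Suc c) - qX ^ (r * c + s))"
    unfolding geom_power_mult
    by (intro sum.cong refl) (simp add: r algebra_simps flip: power_add)
  also have "\<dots> = (\<Sum>c<p - 1. qX ^ (r * Suc c)) - (\<Sum>c<p - 1. qX ^ (r * c + s))"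
    by (rule sum_subtractf)
  finally have N: "(qX ^ p - 1) * ?N =
    (\<Sum>c<p - 1. qX ^ (r * Suc c)) - (\<Sum>c<p - 1. qX ^ (r * c + s))" .
  have p: "p = Suc (p - 1)"
    using gt by simp
  \<comment> \<open>The end exponent p (r - q) of T is computed after adding p q, which avoids
    truncated subtraction.\<close>
  have "p * (r - q) + p * q = p * r"
    using qr by (simp flip: distrib_left)
  also have "\<dots> = r * (p - 1) + r"
    using gt by (cases p) simp_all
  also have "\<dots> = (r * (p - 1) + s) + p * q"
    by (subst (2) r) (rule add.assoc[symmetric])
  finally have "p * (r - q) + p * q = (r * (p - 1) + s) + p * q" .
  hence "p * (r - q) = r * (p - 1) + s"
    by (rule add_right_imp_eq)
  hence T: "(qX ^ p - 1) * ?T = qX ^ (r * (p - 1) + s) - 1"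
    by (simp only: geom_power_mult)
  have "(qX ^ p - 1) * (?T - ?N) =
      ((\<Sum>c<p - 1. qX ^ (r * c + s)) + qX ^ (r * (p - 1) + s)) -
      (1 + (\<Sum>c<p - 1. qX ^ (r * Suc c)))"
    unfolding right_diff_distrib[of _ ?T] N T by simp
  also have "(\<Sum>c<p - 1. qX ^ (r * c + s)) + qX ^ (r * (p - 1) + s) = (\<Sum>c<p. qX ^ (r * c + s))"
    by (subst (3) p) (simp only: sum.lessThan_Suc)
  also have "1 + (\<Sum>c<p - 1. qX ^ (r * Suc c)) = (\<Sum>c<p. qX ^ (r * c))"
    by (subst (2) p) (simp only: sum.lessThan_Suc_shift mult_0_right power_0)
  also have "(\<Sum>c<p. qX ^ (r * c + s)) - (\<Sum>c<p. qX ^ (r * c)) =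
      (qX ^ s - 1) * (\<Sum>c<p. qX ^ (r * c))"
    by (simp add: left_diff_distrib sum_distrib_left power_add mult.commute sum_subtractf)
  also have "\<dots> = (qX ^ p - 1) * ?L"
  proof -
    have "(qX ^ s - 1) * (A * geom p) = (qX ^ p - 1) * (A * geom s)" for A
      unfolding geom_mult[symmetric] by (simp only: mult_ac)
    thus ?thesis
      by (simp only: flip: cyclotomic_rat_prime_product[OF assms(3-5)])
  qed
  finally show ?thesis
    using qX_power_neq_1[of p] gt by simp
qed

text \<open>
  The coefficients of \<open>V\<close> are bounded through those of the power series \<open>E = V / (1 - X)\<close>.
  In degree \<open>n\<close>, \<open>E\<close> accumulates the coefficients of \<open>r - T + N\<close> along the residue class of
  \<open>n\<close> modulo \<open>p\<close>. The class of \<open>0\<close> meets only \<open>r - T\<close>, and every other class meets a single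
  index \<open>c\<close> of \<open>N\<close>, hence \<open>0 \<le> E\<^sub>n < r\<close> and each difference \<open>E\<^sub>n - E\<^sub>n\<^sub>-\<^sub>1\<close> is below \<open>r\<close>.
\<close>

lemma inverses_prime_product_prime:
  assumes "prime p" "prime r" "p \<noteq> r"
  obtains V where "cyclotomic_inv_mod (p * r) p = smult (1 / of_nat r) (geom (r mod p))"
    "cyclotomic_inv_mod p (p * r) = smult (1 / of_nat r) V"
    "\<And>i. \<exists>k::int. coeff V i = of_int k \<and> k < int r"
proof -
  have gt: "p > 1" "r > 1" and cop: "coprime r p"
    using assms by (simp_all add: prime_gt_1_nat primes_coprime del: One_nat_def)
  define q s where "q = r div p" and "s = r mod p"
  have q: "q < r"
    using gt by (simp add: q_def)
  have s: "s < p"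
    using gt by (simp add: s_def)
  \<comment> \<open>\<open>geom r\<close> has too large a degree for W when r > p; reducing r modulo
    p brings it below phi(p) = p - 1.\<close>
  have "[geom s = geom r] (mod geom p)"
    by (intro geom_cong) (simp add: s_def cong_def)
  hence "[cyclotomic_rat (p * r) * geom s = of_nat r] (mod geom p)"
    using cyclotomic_rat_prime_product_cong[OF assms]
    by (rule cong_trans[OF cong_mult[OF cong_refl]])
  hence "geom p dvd of_nat r - cyclotomic_rat (p * r) * geom s"
    by (simp only: cong_iff_dvd_diff dvd_diff_commute)
  then obtain V where V: "of_nat r - cyclotomic_rat (p * r) * geom s = geom p * V" ..
  have "smult (1 / of_nat r) (of_nat r) = (1 :: rat poly)"
    using gt by (simp add: of_nat_poly one_pCons)
  with arg_cong[OF V, of "smult (1 / of_nat r)"]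
  have bezout: "cyclotomic_rat p * smult (1 / of_nat r) V +
      cyclotomic_rat (p * r) * smult (1 / of_nat r) (geom s) = 1"
    using assms by (simp add: cyclotomic_rat_prime smult_diff_right algebra_simps)
  have "degree (smult (1 / of_nat r) (geom s)) < totient p"
    using degree_geom_le[of s] s assms gt by (simp add: totient_prime)
  from cyclotomic_bezout[OF _ _ _ bezout this]
  have inv: "cyclotomic_inv_mod p (p * r) = smult (1 / of_nat r) V"
    "cyclotomic_inv_mod (p * r) p = smult (1 / of_nat r) (geom s)"
    using gt by simp_all
  define T N where "T = (\<Sum>j<r - q. qX ^ (p * j))"
    and "N = (\<Sum>(c, j)\<in>{..<p - 1} \<times> {..<q}. qX ^ (r * c + s + p * j))"
  have "V * (1 - qX ^ p) = - (V * ((qX - 1) * geom p))"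
    unfolding geom_mult by (simp add: right_diff_distrib)
  also have "\<dots> = (1 - qX) * (geom p * V)"
    by (simp add: algebra_simps)
  also have "\<dots> = (1 - qX) * (of_nat r - T + N)"
    using V cyclotomic_product_mult_geom_mod[OF assms] by (simp add: T_def N_def q_def s_def)
  finally have "V * (1 - qX ^ p) = (1 - qX) * (of_nat r - T + N)" .
  from arg_cong[OF this, of fps_of_poly]
  have "fps_of_poly V * (1 - fps_X ^ p) = (1 - fps_X) * (of_nat r - fps_of_poly T + fps_of_poly N)"
    by (simp add: fps_of_poly_mult fps_of_poly_diff fps_of_poly_add fps_of_poly_power
        fps_of_poly_qX fps_of_poly_of_nat)
  hence V_eq: "fps_of_poly V = (1 - fps_X) * (of_nat r - fps_of_poly T + fps_of_poly N) * fps_multiples p"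
    using gt by (intro fps_mult_multiples_cancel) auto
  define E where "E = (of_nat r - fps_of_poly T + fps_of_poly N) * fps_multiples p"
  have VE: "fps_of_poly V = E - fps_X * E"
    unfolding V_eq E_def by (simp only: left_diff_distrib mult_1_left mult.assoc)
  have E: "\<exists>k::int. fps_nth E n = of_int k \<and> 0 \<le> k \<and> k < int r" for n
  proof -
    define CT where "CT = {j \<in> {..<r - q}. p * j \<le> n \<and> p dvd n - p * j}"
    define e :: "nat \<times> nat \<Rightarrow> nat" where "e = (\<lambda>(c, j). r * c + s + p * j)"
    define CN where "CN = {x \<in> {..<p - 1} \<times> {..<q}. e x \<le> n \<and> p dvd n - e x}"
    have "fps_of_poly T = (\<Sum>j<r - q. fps_X ^ (p * j))"
      by (simp add: T_def fps_of_poly_sum fps_of_poly_power fps_of_poly_qX)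
    moreover have "fps_of_poly N = (\<Sum>x\<in>{..<p - 1} \<times> {..<q}. fps_X ^ e x)"
      by (simp add: N_def e_def fps_of_poly_sum fps_of_poly_power fps_of_poly_qX case_prod_unfold)
    ultimately have "fps_nth E n =
        fps_nth (of_nat r * fps_multiples p) n - of_nat (card CT) + of_nat (card CN)"
      by (simp add: E_def CT_def CN_def distrib_right left_diff_distrib
          nth_sum_power_mult_multiples)
    also have "fps_nth (of_nat r * fps_multiples p) n = of_nat r * (if p dvd n then 1 else 0)"
      by (simp add: fps_multiples_def flip: fps_of_nat)
    finally have nth: "fps_nth E n =
        of_int (int r * (if p dvd n then 1 else 0) - int (card CT) + int (card CN))"
      by simp
    \<comment> \<open>s is congruent to r, so the residue depends on c only.\<close>
    have e: "[e (c, j) = r * Suc c] (mod p)" for c j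
      by (simp add: e_def s_def cong_def mod_simps add.commute)
    have CN: "[r * Suc c = n] (mod p)" "c < p - 1" "j < q" if "(c, j) \<in> CN" for c j
      using that dvd_diff_cong[of "e (c, j)" n p] e[of c j] unfolding CN_def
      by (auto simp: cong_def)
    show ?thesis
    proof (cases "p dvd n")
      case True
      have "CN = {}"
      proof (rule ccontr)
        assume "CN \<noteq> {}"
        then obtain c j where cj: "(c, j) \<in> CN" by auto
        have "[r * Suc c = r * 0] (mod p)"
          using CN(1)[OF cj] True by (auto simp: cong_def)
        hence "Suc c = 0"
          using CN(2)[OF cj] by (intro cong_mult_left_bounded[OF cop]) auto
        thus False by simp
      qed
      moreover have "card CT \<le> r - q"
        using card_mono[of "{..<r - q}" CT] by (auto simp: CT_def)
      \<comment> \<open>The index j = 0 is counted because q < r; this makes the bound by r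
        strict.\<close>
      moreover have "0 \<in> CT" "finite CT"
        using True q by (auto simp: CT_def)
      hence "card CT > 0"
        by (auto simp: card_gt_0_iff)
      ultimately show ?thesis
        using True by (intro exI[of _ "int r - int (card CT)"]) (simp add: nth)
    next
      case False
      have "CT = {}"
      proof -
        have "p dvd n" if "p * j \<le> n" "p dvd n - p * j" for j
          using that by (metis dvd_diffD dvd_triv_left)
        thus ?thesis using False by (auto simp: CT_def)
      qed
      \<comment> \<open>The residue of n fixes c, so a pair in \<open>CN\<close> is known from j <
        q, and q < r.\<close>
      moreover have "inj_on snd CN"
      proof (rule inj_onI)
        fix x y assume xy: "x \<in> CN" "y \<in> CN" "snd x = snd y"
        obtain c j c' j' where [simp]: "x = (c, j)" "y = (c', j')"
          by fastforce
        have "[r * Suc c = r * Suc c'] (mod p)"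
          using CN(1)[of c j] CN(1)[of c' j'] xy by (simp add: cong_def)
        hence "Suc c = Suc c'"
          using CN(2)[of c j] CN(2)[of c' j'] xy by (intro cong_mult_left_bounded[OF cop]) auto
        thus "x = y"
          using xy by simp
      qed
      hence "card CN \<le> card {..<q}"
        using CN(3) by (intro card_inj_on_le[of snd]) auto
      ultimately show ?thesis
        using False q by (intro exI[of _ "int (card CN)"]) (simp add: nth)
    qed
  qed
  have "\<exists>k::int. coeff V i = of_int k \<and> k < int r" for i
  proof (cases i)
    case 0
    thus ?thesis
      using E[of 0] by (simp add: VE flip: fps_of_poly_nth) blast
  next
    case (Suc j)
    obtain k l :: int where k: "fps_nth E i = of_int k" "k < int r"
      and l: "fps_nth E j = of_int l" "0 \<le> l"
      using E[of i] E[of j] by blast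
    have "coeff V i = of_int (k - l)"
      using k l Suc by (simp add: VE flip: fps_of_poly_nth)
    thus ?thesis
      using k l by (intro exI[of _ "k - l"]) simp
  qed
  with inv show ?thesis
    by (intro that) (simp_all add: s_def)
qed

section \<open>Assembling the four statements\<close>

theorem theorem1:
  fixes p r :: nat
  assumes "prime p" and "prime r" and "p \<noteq> r"
  shows
    "(cyclotomic_inv_mod p 1 = [:1 / of_nat p:] \<and>
      cyclotomic_inv_mod 1 p =
        smult (- (1 / of_nat p)) (\<Sum>k = 0..p - 2. monom (of_nat p - 1 - of_nat k) k)) \<and>
     (cyclotomic_inv_mod (p * r) 1 = 1 \<and>
      (\<exists>v :: nat \<Rightarrow> int.
         cyclotomic_inv_mod 1 (p * r) = (\<Sum>i = 0..totient (p * r) - 1. monom (of_int (v i)) i) \<and>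
         (\<forall>i \<in> {0..totient (p * r) - 1}. v i \<in> {-1, 0, 1}))) \<and>
     ((\<forall>d :: nat. [d = r - 1] (mod p) \<longrightarrow>
         [cyclotomic_rat (p * r) * smult (1 / of_nat r) (\<Sum>i = 0..d. monom 1 i) = 1]
           (mod cyclotomic_rat p) \<and>
         cyclotomic_inv_mod (p * r) p =
           smult (1 / of_nat r) (\<Sum>i = 0..d. monom 1 i) mod cyclotomic_rat p) \<and>
      (\<exists>v :: nat \<Rightarrow> int.
         cyclotomic_inv_mod p (p * r) =
           smult (1 / of_nat r) (\<Sum>i = 0..totient (p * r) - 1. monom (of_int (v i)) i) \<and>
         (\<forall>i \<in> {0..totient (p * r) - 1}. v i < int r))) \<and>
     (\<exists>v :: nat \<Rightarrow> int.
        cyclotomic_inv_mod p r = (\<Sum>i = 0..totient r - 1. monom (of_int (v i)) i) \<and>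
        (\<forall>i \<in> {0..totient r - 1}. v i \<in> {-1, 0, 1}))"
proof -
  have gt: "p > 1" "r > 1"
    using assms by (simp_all add: prime_gt_1_nat del: One_nat_def)
  have ne: "1 \<noteq> p * r" "p \<noteq> p * r" "p * r \<noteq> p" and pos: "p * r > 0"
    using gt by auto
  have unit: "\<exists>k::int. x = of_int k \<and> k \<in> {-1, 0, 1}" if "x \<in> {-1, 0, 1}" for x :: rat
    using that by (elim insertE) (force intro: exI[of _ "-1"] exI[of _ 0] exI[of _ 1])+
  define U where "U = cyclotomic_inv_mod 1 (p * r)"
  have "degree U < totient (p * r)"
    using cyclotomic_inv_mod(1)[of 1 "p * r"] ne pos by (simp add: U_def)
  hence ii: "\<exists>v :: nat \<Rightarrow> int. U = (\<Sum>i = 0..totient (p * r) - 1. monom (of_int (v i)) i) \<and>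
      (\<forall>i \<in> {0..totient (p * r) - 1}. v i \<in> {-1, 0, 1})"
    using inverses_prime_product_1(2)[OF assms]
    by (intro poly_eq_sum_of_int_monoms unit) (auto simp: U_def)
  obtain V where V: "cyclotomic_inv_mod (p * r) p = smult (1 / of_nat r) (geom (r mod p))"
      "cyclotomic_inv_mod p (p * r) = smult (1 / of_nat r) V"
      "\<And>i. \<exists>k::int. coeff V i = of_int k \<and> k < int r"
    using inverses_prime_product_prime[OF assms] by blast
  \<comment> \<open>The factor 1/r is nonzero, so V has the degree of the inverse.\<close>
  have "degree V < totient (p * r)"
    using cyclotomic_inv_mod(1)[of p "p * r"] ne pos gt V(2) by simp
  hence iii: "\<exists>v :: nat \<Rightarrow> int. V = (\<Sum>i = 0..totient (p * r) - 1. monom (of_int (v i)) i) \<and>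
      (\<forall>i \<in> {0..totient (p * r) - 1}. v i < int r)"
    using V(3) by (intro poly_eq_sum_of_int_monoms)
  define W where "W = cyclotomic_inv_mod p r"
  have "degree W < totient r"
    using cyclotomic_inv_mod(1)[of p r] assms gt by (auto simp: W_def)
  hence iv: "\<exists>v :: nat \<Rightarrow> int. W = (\<Sum>i = 0..totient r - 1. monom (of_int (v i)) i) \<and>
      (\<forall>i \<in> {0..totient r - 1}. v i \<in> {-1, 0, 1})"
    using inverse_mod_prime[OF assms]
    by (intro poly_eq_sum_of_int_monoms unit) (auto simp: W_def)
  have d: "[cyclotomic_rat (p * r) * smult (1 / of_nat r) (\<Sum>i = 0..d. monom 1 i) = 1]
        (mod cyclotomic_rat p) \<and>
      cyclotomic_inv_mod (p * r) p =
        smult (1 / of_nat r) (\<Sum>i = 0..d. monom 1 i) mod cyclotomic_rat p"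
    if "[d = r - 1] (mod p)" for d
  proof
    let ?I = "cyclotomic_inv_mod (p * r) p"
    have inv: "degree ?I < totient p" "[cyclotomic_rat (p * r) * ?I = 1] (mod cyclotomic_rat p)"
      using cyclotomic_inv_mod[of "p * r" p] ne pos gt by simp_all
    \<comment> \<open>The sum over 0..d has d + 1 terms and d + 1 is congruent to r, so it reduces
      to the sum with r mod p terms.\<close>
    have "[Suc d = Suc (r - 1)] (mod p)"
      using cong_add[OF that cong_refl, of 1] by simp
    hence "[Suc d = r mod p] (mod p)"
      using gt by (simp add: cong_def)
    hence "[geom (Suc d) = geom (r mod p)] (mod cyclotomic_rat p)"
      using assms by (simp add: cyclotomic_rat_prime geom_cong)
    hence *: "[smult (1 / of_nat r) (\<Sum>i = 0..d. monom 1 i) = ?I] (mod cyclotomic_rat p)"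
      by (simp add: V(1) sum_monom_eq_geom cong_def mod_smult_left)
    show "[cyclotomic_rat (p * r) * smult (1 / of_nat r) (\<Sum>i = 0..d. monom 1 i) = 1]
        (mod cyclotomic_rat p)"
      using cong_mult[OF cong_refl *] inv(2) by (rule cong_trans)
    \<comment> \<open>The inverse is already reduced, so the congruence becomes an equality of
      remainders.\<close>
    have "?I mod cyclotomic_rat p = ?I"
      using inv(1) gt by (intro mod_poly_less) (simp add: degree_cyclotomic_rat)
    thus "?I = smult (1 / of_nat r) (\<Sum>i = 0..d. monom 1 i) mod cyclotomic_rat p"
      using * by (simp add: cong_def)
  qed
  show ?thesis
    unfolding V(2) inverses_prime_product_1(1)[OF assms] U_def[symmetric] W_def[symmetric]
  proof (intro conjI)
    show "\<exists>v :: nat \<Rightarrow> int.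
        smult (1 / of_nat r) V =
          smult (1 / of_nat r) (\<Sum>i = 0..totient (p * r) - 1. monom (of_int (v i)) i) \<and>
        (\<forall>i \<in> {0..totient (p * r) - 1}. v i < int r)"
      using iii by auto
  qed (use inverses_prime_1[OF assms(1)] ii iv d in \<open>auto simp del: One_nat_def\<close>)
qed

end
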